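(* Let $n\ge 1$. Then $\alpha_n(\pi_n)=\pi_n$. Moreover, let $\sigma\in D_n$ with $\sigma\ne\pi_n$, and let $j$ be the smallest integer with $1\le j\le n+1$ and $j\equiv n+1 \pmod 2$ such that $(k\;\,k+1)$ is a cycle of $\sigma$ for every $k\in\{j,j+2,\dots,n-1\}$ (so $j=n+1$ if $\sigma$ does not end with such a run of transpositions). Then $j\ge 2$; put $a=\sigma(j-1)$. Then $\alpha_n(\sigma)=\tau$, where: Case 1: if $\sigma(a)=j-1$ (i.e. $j-1$ lies in a $2$-cycle of $\sigma$), let $b=\sigma(j-2)$; then $\tau(j-2)=a$, $\tau(a)=b$, $\tau(x)=\sigma(x)$ for all other $x<j-1$, $\tau$ interchanges $k$ and $k+1$ for each $k\in\{j-1,j+1,\dots,n-2\}$, and $\tau(n)=n$. (In cycle notation: $\sigma=(\cdots)(\cdots\, j-2\;\, b\,\cdots)(j-1\;\,a)(j\;\,j+1)\cdots(n-1\;\,n)$ is sent to $(\cdots)(\cdots\, j-2\;\,a\;\,b\,\cdots)(j-1\;\,j)\cdots(n-2\;\,n-1)(n)$.) Case 2: if $\sigma(a)\ne j-1$ (i.e. $j-1$ lies in a cycle of length at least $3$), let $b=\sigma(a)$; then $\tau(j-1)=b$ and $\tau(x)=\sigma(x)$ for all $x<j$ with $x\notin\{j-1,a\}$; if $j=n+1$ then $\tau(a)=a$; if $j\le n-1$ then $\tau(j)=a$, $\tau(a)=j$, $\tau$ interchanges $k$ and $k+1$ for each $k\in\{j+1,j+3,\dots,n-2\}$, and $\tau(n)=n$.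 (In cycle notation: $\sigma=(\cdots)(\cdots\, j-1\;\,a\;\,b\,\cdots)(j\;\,j+1)\cdots(n-1\;\,n)$ is sent to $(\cdots)(\cdots\, j-1\;\,b\,\cdots)(j\;\,a)(j+1\;\,j+2)\cdots(n-2\;\,n-1)(n)$, with all entries greater than $n$ deleted.)
   Context: For $n \geq 0$ let $\mathfrak{S}_n$ be the set of permutations of $[n]=\{1,\dots,n\}$ ($\mathfrak{S}_0$ consists of the empty permutation $()$), written in disjoint cycle notation. Let $D_n\subseteq \mathfrak{S}_n$ be the set of derangements (permutations with no fixed point) and $E_n \subseteq \mathfrak{S}_n$ the set of permutations with exactly one fixed point. Define $\pi_n = (1\,2)(3\,4)\cdots(n-1\;n)$ if $n$ is even and $\pi_n=(1\,2)(3\,4)\cdots(n-2\;\,n-1)(n)$ if $n$ is odd; so $\pi_0=()$, $\pi_1=(1)$, $\pi_n\in D_n$ for $n$ even and $\pi_n \in E_n$ for $n$ odd. Let $\Pi_n=\{\pi_n\}$. For $\sigma\in\mathfrak{S}_n$ and $a\in[n]$, $\sigma\setminus a$ denotes the permutation of $[n]\setminus\{a\}$ obtained by deleting $a$ from the disjoint cycle decomposition of $\sigma$: $(\sigma\setminus a)(x)=\sigma(x)$ if $\sigma(x)\neq a$, and $(\sigma\setminus a)(\sigma^{-1}(a))=\sigma(a)$ if $\sigma(a)\ne a$. In particular $\sigma\setminus n\in\mathfrak{S}_{n-1}$. For $n\ge 1$ define the bijection $f_n:[n]\times D_{n-1}\to E_n$ by: for $m<n$, $f_n(m,\sigma)$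 is the permutation $\tau$ of $[n]$ obtained by replacing $m$ by $n$ in the cycle decomposition of $\sigma$ and adding the fixed point $m$ (i.e. $\tau(m)=m$, $\tau(\sigma^{-1}(m))=n$, $\tau(n)=\sigma(m)$, $\tau(x)=\sigma(x)$ otherwise); and $f_n(n,\sigma)$ is $\sigma$ with the fixed point $n$ appended. Define bijections $\alpha_n$ recursively: for $n$ even, $\alpha_n: D_n\to E_n\sqcup \Pi_n$; for $n$ odd, $\alpha_n: D_n\sqcup\Pi_n\to E_n$ (these unions are disjoint). Let $\alpha_0$ send $()$ to $\pi_0$ and $\alpha_1$ send $\pi_1$ to $(1)$. For $n\ge 2$ and $\sigma$ in the domain of $\alpha_n$, with $\alpha_{n-1}^{-1}$ the inverse of the bijection $\alpha_{n-1}$: (i) if $\sigma\in D_n$ and $n$ lies in a cycle of $\sigma$ of length at least $3$, then $\alpha_n(\sigma)=f_n(\sigma(n),\sigma\setminus n)$; (ii) if $\sigma\in D_n$ and $n$ lies in a $2$-cycle of $\sigma$, then $\sigma\setminus n\in E_{n-1}$; let $\rho=\alpha_{n-1}^{-1}(\sigma\setminus n)$. If $\rho\in D_{n-1}$, then $\alpha_n(\sigma)=f_n(n,\rho)$; if $\rho=\pi_{n-1}\in\Pi_{n-1}$ (possible only for $n$ even), then $\alpha_n(\sigma)=\pi_n\in\Pi_n$; (iii) if $n$ is odd and $\sigma=\pi_n\in\Pi_n$, then $\alpha_n(\pi_n)=f_n\big(n,\alpha_{n-1}^{-1}(\pi_{n-1})\big)$, where $\pi_{n-1}$ is regarded as the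 element of $\Pi_{n-1}$ in the domain of $\alpha_{n-1}^{-1}$. *)

theory Defs
  imports Main "HOL-Combinatorics.Orbits"
begin

text \<open>
  A permutation of \<open>{1..n}\<close> is a function on \<open>nat\<close> satisfying \<open>permutes\<close>, hence the identity
  outside \<open>{1..n}\<close>. Fixed points are only counted inside \<open>{1..n}\<close>; a permutation of
  \<open>{1..n - 1}\<close> and the permutation of \<open>{1..n}\<close> with the fixed point \<open>n\<close> appended are the same
  function.
\<close>

definition derangements :: "nat \<Rightarrow> (nat \<Rightarrow> nat) set" where
  "derangements n = {\<sigma>. \<sigma> permutes {1..n} \<and> (\<forall>x\<in>{1..n}. \<sigma> x \<noteq> x)}"

definition one_fixpoint_perms :: "nat \<Rightarrow> (nat \<Rightarrow> nat) set" where
  "one_fixpoint_perms n = {\<sigma>. \<sigma> permutes {1..n} \<and> (\<exists>!x. x \<in> {1..n} \<and> \<sigma> x = x)}"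

text \<open>The permutation \<open>(1 2)(3 4)\<dots>\<close>, with fixed point \<open>n\<close> when \<open>n\<close> is odd.\<close>

definition pi_perm :: "nat \<Rightarrow> nat \<Rightarrow> nat" where
  "pi_perm n x =
     (if 1 \<le> x \<and> x \<le> 2 * (n div 2) then (if odd x then x + 1 else x - 1) else x)"

text \<open>
  Deletion of \<open>a\<close> from the cycle decomposition; the deleted point becomes a fixed point of the
  function on \<open>nat\<close>.
\<close>

definition delete_point :: "(nat \<Rightarrow> nat) \<Rightarrow> nat \<Rightarrow> nat \<Rightarrow> nat" where
  "delete_point \<sigma> a x = (if x = a then a else if \<sigma> x = a then \<sigma> a else \<sigma> x)"

text \<open>
  The bijection from \<open>{1..n} \<times> derangements (n - 1)\<close> to \<open>one_fixpoint_perms n\<close>. In the second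
  branch \<open>n\<close> is already a fixed point of \<open>\<sigma>\<close> as a function on \<open>nat\<close>.
\<close>

definition insert_fixpoint :: "nat \<Rightarrow> nat \<Rightarrow> (nat \<Rightarrow> nat) \<Rightarrow> nat \<Rightarrow> nat" where
  "insert_fixpoint n m \<sigma> =
     (if m < n
      then (\<lambda>x. if x = m then m else if x = n then \<sigma> m else if \<sigma> x = m then n else \<sigma> x)
      else \<sigma>)"

definition alpha_domain :: "nat \<Rightarrow> (nat \<Rightarrow> nat) set" where
  "alpha_domain n = (if even n then derangements n else derangements n \<union> {pi_perm n})"

text \<open>
  For even \<open>n\<close> the codomain of \<open>alpha n\<close> is \<open>one_fixpoint_perms n \<union> {pi_perm n}\<close>, for odd \<open>n\<close> it
  is \<open>one_fixpoint_perms n\<close>. The values of \<open>alpha n\<close> outside \<open>alpha_domain n\<close> are irrelevant: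
  the inverse of \<open>alpha n\<close> is taken relative to \<open>alpha_domain n\<close>.
\<close>

fun alpha :: "nat \<Rightarrow> (nat \<Rightarrow> nat) \<Rightarrow> (nat \<Rightarrow> nat)" where
  "alpha 0 \<sigma> = pi_perm 0"
| "alpha (Suc 0) \<sigma> = id"
| "alpha (Suc (Suc k)) \<sigma> =
     (let n = Suc (Suc k);
          alpha_inv = inv_into (alpha_domain (Suc k)) (\<lambda>\<rho>. alpha (Suc k) \<rho>)
      in if \<sigma> \<in> derangements n \<and> card (orbit \<sigma> n) \<ge> 3 then
           insert_fixpoint n (\<sigma> n) (delete_point \<sigma> n)
         else if \<sigma> \<in> derangements n \<and> card (orbit \<sigma> n) = 2 then
           (let \<rho> = alpha_inv (delete_point \<sigma> n)
            in if \<rho> \<in> derangements (n - 1) then insert_fixpoint n n \<rho> else pi_perm n)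
         else if odd n \<and> \<sigma> = pi_perm n then
           insert_fixpoint n n (alpha_inv (pi_perm (n - 1)))
         else undefined)"

text \<open>The arithmetic progression \<open>a, a + 2, \<dots>\<close> up to \<open>b\<close>, empty if \<open>a > b\<close>.\<close>

definition every_second :: "nat \<Rightarrow> nat \<Rightarrow> nat set" where
  "every_second a b = {k \<in> {a..b}. even (k - a)}"

definition is_2cycle_of :: "(nat \<Rightarrow> nat) \<Rightarrow> nat \<Rightarrow> nat \<Rightarrow> bool" where
  "is_2cycle_of \<sigma> x y \<longleftrightarrow> x \<noteq> y \<and> \<sigma> x = y \<and> \<sigma> y = x"

text \<open>
  Start of the maximal final run \<open>(j j+1)(j+2 j+3)\<dots>(n-1 n)\<close> of transpositions in \<open>\<sigma>\<close>. The
  minimum exists since \<open>j = n + 1\<close> always qualifies.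
\<close>

definition run_start :: "nat \<Rightarrow> (nat \<Rightarrow> nat) \<Rightarrow> nat" where
  "run_start n \<sigma> =
     (LEAST j. 1 \<le> j \<and> j \<le> n + 1 \<and> j mod 2 = (n + 1) mod 2 \<and>
        (\<forall>k\<in>every_second j (n - 1). is_2cycle_of \<sigma> k (k + 1)))"

end

theory Submission
  imports Defs
begin

text \<open>
  Write \<open>c\<close> for the map \<open>\<sigma> \<mapsto> \<sigma> \<circ> (n \<sigma>(n))\<close>, called \<open>split_last\<close> below. In case (i) of the recursion
  \<open>\<alpha>\<^sub>n(\<sigma>) = c(\<sigma>)\<close>, and in case (ii) \<open>\<sigma> \<setminus> n = c(\<sigma>)\<close>; since \<open>\<pi>\<^sub>n = \<pi>\<^bsub>n-1\<^esub>\<close> as functions for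
  odd \<open>n\<close>, case (iii) has the shape of case (ii). Bijectivity of \<open>\<alpha>\<^sub>n\<close> follows from that of \<open>c\<close> by
  induction. A preimage of \<open>c(\<sigma>)\<close> under \<open>\<alpha>\<^bsub>n-1\<^esub>\<close> can then be written down explicitly. If
  \<open>\<sigma>(n) = a\<close> with \<open>a < n - 1\<close> and \<open>\<sigma>(a) = n\<close>, it is \<open>c(\<sigma>) \<circ> (n-1 a)\<close>. If \<open>\<sigma>\<close> ends with the
  transposition \<open>(n-1 n)\<close>, it is \<open>\<alpha>\<^bsub>n-2\<^esub>(c(\<sigma>)) \<circ> (n-1 m)\<close>, where \<open>m\<close> is the fixed point of
  \<open>\<alpha>\<^bsub>n-2\<^esub>(c(\<sigma>))\<close>. The closed formula follows by induction in steps of two.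
\<close>

section \<open>Derangements and the map \<open>split_last\<close>\<close>

definition split_last :: "nat \<Rightarrow> (nat \<Rightarrow> nat) \<Rightarrow> nat \<Rightarrow> nat" where
  "split_last n \<sigma> = \<sigma> \<circ> transpose n (\<sigma> n)"

definition alpha_codomain :: "nat \<Rightarrow> (nat \<Rightarrow> nat) set" where
  "alpha_codomain n = one_fixpoint_perms n \<union> (if even n then {pi_perm n} else {})"

text \<open>In cycle notation, \<open>\<sigma> n\<close> is cut out of the cycle of \<open>n\<close>
  and becomes a fixed point.\<close>

lemma split_last_apply:
  "split_last n \<sigma> x = (if x = n then \<sigma> (\<sigma> n) else if x = \<sigma> n then \<sigma> n else \<sigma> x)"
  by (auto simp: split_last_def transpose_def)

lemma derangementsD:
  assumes "\<sigma> \<in> derangements n"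
  shows "\<sigma> permutes {1..n}" "\<And>x. 1 \<le> x \<Longrightarrow> x \<le> n \<Longrightarrow> \<sigma> x \<noteq> x"
    "\<And>x. 1 \<le> x \<Longrightarrow> x \<le> n \<Longrightarrow> 1 \<le> \<sigma> x \<and> \<sigma> x \<le> n" "\<And>x. n < x \<Longrightarrow> \<sigma> x = x" "\<sigma> 0 = 0"
  using assms permutes_in_image[of \<sigma> "{1..n}"] permutes_not_in[of \<sigma> "{1..n}"]
  unfolding derangements_def by fastforce+

lemma permutes_eq_iff: "\<sigma> permutes S \<Longrightarrow> \<sigma> x = \<sigma> y \<longleftrightarrow> x = y"
  by (simp add: permutes_inj inj_eq)

text \<open>Turns the cycle lengths tested by \<open>alpha\<close> into a pointwise condition.
  Length 1 cannot occur in a derangement, so the two tests are complementary.\<close>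

lemma card_orbit_derangement_iff:
  assumes "\<sigma> \<in> derangements n" "n \<ge> 1"
  shows "card (orbit \<sigma> n) \<ge> 3 \<longleftrightarrow> \<sigma> (\<sigma> n) \<noteq> n"
    and "card (orbit \<sigma> n) = 2 \<longleftrightarrow> \<sigma> (\<sigma> n) = n"
proof -
  have p: "\<sigma> permutes {1..n}" and ne: "\<sigma> n \<noteq> n"
    using derangementsD[OF assms(1)] assms(2) by auto
  have two: "card (orbit \<sigma> n) = 2" if "\<sigma> (\<sigma> n) = n"
  proof -
    have "x \<in> {n, \<sigma> n}" if "x \<in> orbit \<sigma> n" for x
      using that by induction (use \<open>\<sigma> (\<sigma> n) = n\<close> in auto)
    moreover have "\<sigma> n \<in> orbit \<sigma> n" "n \<in> orbit \<sigma> n"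
      using orbit.intros(1)[of \<sigma> n] orbit.intros(2)[of "\<sigma> n" \<sigma> n] that by auto
    ultimately have "orbit \<sigma> n = {n, \<sigma> n}"
      by blast
    then show ?thesis
      using ne by simp
  qed
  have three: "card (orbit \<sigma> n) \<ge> 3" if "\<sigma> (\<sigma> n) \<noteq> n"
  proof -
    \<comment> \<open>\<open>orbit \<sigma> n\<close> is generated from \<open>\<sigma> n\<close>;
      that it is finite and returns to \<open>n\<close> comes from the finite support of the
      permutation.\<close>
    have perm: "permutation \<sigma>"
      using p permutation_permutes by blast
    then have "n \<in> orbit \<sigma> n"
      by (rule permutation_self_in_orbit)
    then have "{n, \<sigma> n, \<sigma> (\<sigma> n)} \<subseteq> orbit \<sigma> n"
      using orbit.intros(1)[of \<sigma> n] orbit.intros(2)[of "\<sigma> n" \<sigma> n] by auto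
    moreover have "finite (orbit \<sigma> n)"
      using perm \<open>n \<in> orbit \<sigma> n\<close> by (simp add: finite_orbit)
    moreover have "card {n, \<sigma> n, \<sigma> (\<sigma> n)} = 3"
      using ne that permutes_eq_iff[OF p] by auto
    ultimately show ?thesis
      using card_mono by metis
  qed
  show "card (orbit \<sigma> n) \<ge> 3 \<longleftrightarrow> \<sigma> (\<sigma> n) \<noteq> n" "card (orbit \<sigma> n) = 2 \<longleftrightarrow> \<sigma> (\<sigma> n) = n"
    using two three by fastforce+
qed

text \<open>In a 2-cycle, deleting \<open>n\<close> and cutting out its partner both leave
  \<open>n\<close> and \<open>\<sigma> n\<close> fixed.\<close>

lemma delete_point_two_cycle:
  assumes "\<sigma> permutes S" "\<sigma> (\<sigma> n) = n"
  shows "delete_point \<sigma> n = split_last n \<sigma>"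
  using assms permutes_eq_iff[OF assms(1)]
  by (auto simp: fun_eq_iff delete_point_def split_last_apply; metis)

text \<open>After \<open>n\<close> is deleted, renaming \<open>\<sigma> n\<close> to
  \<open>n\<close> puts \<open>n\<close> where its successor stood. The net effect is to cut out
  that successor.\<close>

lemma insert_fixpoint_delete_point:
  assumes "\<sigma> permutes S" "\<sigma> n < n" "\<sigma> (\<sigma> n) \<noteq> n"
  shows "insert_fixpoint n (\<sigma> n) (delete_point \<sigma> n) = split_last n \<sigma>"
  using assms permutes_eq_iff[OF assms(1)]
  by (auto simp: fun_eq_iff delete_point_def insert_fixpoint_def split_last_apply)

lemma split_last_permutes:
  assumes "\<sigma> permutes {1..n}" "n \<ge> 1"
  shows "split_last n \<sigma> permutes {1..n}"
proof -
  have "\<sigma> n \<in> {1..n}"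
    using assms permutes_in_image[OF assms(1), of n] by simp
  then have "transpose n (\<sigma> n) permutes {1..n}"
    using assms(2) by (intro permutes_swap_id) auto
  then show ?thesis
    unfolding split_last_def using assms(1) permutes_compose by blast
qed

lemma permutes_shrink:
  fixes n :: nat
  assumes "\<sigma> permutes {1..n}" "\<sigma> n = n"
  shows "\<sigma> permutes {1..n - 1}"
proof (rule permutes_superset[OF assms(1)])
  show "\<sigma> x = x" if "x \<in> {1..n} - {1..n - 1}" for x
  proof -
    have "x = n" using that by (cases n) auto
    then show ?thesis using assms(2) by simp
  qed
qed

lemma permutes_extend: "\<sigma> permutes {1..n - 1} \<Longrightarrow> \<sigma> permutes {1..(n::nat)}"
  by (rule permutes_subset) auto

text \<open>The image determines \<open>\<sigma> n\<close>: it is the only point other than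
  \<open>n\<close> that \<open>split_last n \<sigma>\<close> can fix. Composing with the same
  transposition again then recovers \<open>\<sigma>\<close>.\<close>

lemma inj_on_split_last:
  assumes "n \<ge> 1"
  shows "inj_on (split_last n) (derangements n)"
proof (rule inj_onI)
  fix \<sigma> \<sigma>' assume s: "\<sigma> \<in> derangements n" "\<sigma>' \<in> derangements n" "split_last n \<sigma> = split_last n \<sigma>'"
  note d = derangementsD[OF s(1)] derangementsD[OF s(2)]
  have "\<sigma> n \<noteq> n" "1 \<le> \<sigma> n" "\<sigma> n \<le> n"
    using d(2,3)[of n] assms by auto
  moreover have "split_last n \<sigma>' (\<sigma> n) = \<sigma> n"
    using s(3) \<open>\<sigma> n \<noteq> n\<close> by (metis split_last_apply)
  moreover have "split_last n \<sigma>' (\<sigma> n) = \<sigma>' (\<sigma> n)" if "\<sigma> n \<noteq> \<sigma>' n"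
    using that \<open>\<sigma> n \<noteq> n\<close> by (simp add: split_last_apply)
  ultimately have "\<sigma> n = \<sigma>' n"
    using d(7)[of "\<sigma> n"] by metis
  then have "\<sigma> \<circ> transpose n (\<sigma> n) = \<sigma>' \<circ> transpose n (\<sigma> n)"
    using s(3) by (simp add: split_last_def)
  then have "\<sigma> \<circ> transpose n (\<sigma> n) \<circ> transpose n (\<sigma> n) = \<sigma>' \<circ> transpose n (\<sigma> n) \<circ> transpose n (\<sigma> n)"
    by simp
  then show "\<sigma> = \<sigma>'"
    by (simp add: comp_assoc)
qed

text \<open>Inverts \<open>split_last\<close> by inserting \<open>m\<close> right after
  \<open>n\<close>. Uniqueness of the fixed point is asked only below \<open>n\<close>, so that both
  situations are covered: \<open>n\<close> fixed by \<open>\<tau>\<close>, which yields a 2-cycle,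
  and \<open>n\<close> moved, which yields a longer cycle.\<close>

lemma join_last:
  assumes "\<tau> permutes {1..n}" "1 \<le> m" "m < n" "\<tau> m = m"
    and "\<And>x. 1 \<le> x \<Longrightarrow> x < n \<Longrightarrow> \<tau> x = x \<Longrightarrow> x = m"
  shows "\<tau> \<circ> transpose n m \<in> derangements n"
    and "split_last n (\<tau> \<circ> transpose n m) = \<tau>"
proof -
  have "transpose n m permutes {1..n}"
    using assms(2,3) by (intro permutes_swap_id) auto
  then have p: "\<tau> \<circ> transpose n m permutes {1..n}"
    using assms(1) permutes_compose by blast
  have "(\<tau> \<circ> transpose n m) x \<noteq> x" if "1 \<le> x" "x \<le> n" for x
  proof -
    consider "x = n" | "x = m" "m \<noteq> n" | "x \<noteq> n" "x \<noteq> m"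
      by blast
    then show ?thesis
    proof cases
      case 1
      then show ?thesis using assms(3,4) by simp
    next
      case 2
      then show ?thesis using permutes_eq_iff[OF assms(1), of n m] assms(4) by auto
    next
      case 3
      then show ?thesis using assms(5)[of x] that by auto
    qed
  qed
  then show "\<tau> \<circ> transpose n m \<in> derangements n"
    using p by (auto simp: derangements_def)
  show "split_last n (\<tau> \<circ> transpose n m) = \<tau>"
    using assms(4) by (simp add: split_last_def comp_assoc)
qed

section \<open>The permutation \<open>pi_perm\<close>\<close>

text \<open>Trades the bound \<open>2 * (n div 2)\<close> for parity conditions, so that later facts
  on \<open>pi_perm\<close> become three-way case distinctions.\<close>

lemma pi_perm_cases:
  obtains (odd) "odd x" "x < n" "pi_perm n x = x + 1"
  | (even) "even x" "0 < x" "x \<le> n" "pi_perm n x = x - 1"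
  | (out) "x = 0 \<or> n < x \<or> (odd n \<and> x = n)" "pi_perm n x = x"
proof -
  have eq: "x \<le> 2 * (n div 2) \<longleftrightarrow> (if odd n then x < n else x \<le> n)"
    by presburger
  have pos: "0 < x" "even n \<Longrightarrow> x \<le> n \<Longrightarrow> x < n" if "odd x"
    using that by (auto intro: odd_pos simp: le_less)
  consider "odd x" "x < n" | "even x" "0 < x" "x \<le> n" "even n \<or> x < n" | "x = 0 \<or> n < x \<or> (odd n \<and> x = n)"
    using pos by fastforce
  then show ?thesis
  proof cases
    case 1
    then show ?thesis using odd eq pos by (auto simp: pi_perm_def)
  next
    case 2
    then show ?thesis using even eq by (auto simp: pi_perm_def)
  next
    case 3
    then show ?thesis using out eq by (auto simp: pi_perm_def split: if_splits)
  qed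
qed

lemma pi_perm_involution: "pi_perm n (pi_perm n x) = x"
proof (cases n x rule: pi_perm_cases)
  case odd
  then show ?thesis by (cases n "x + 1" rule: pi_perm_cases) auto
next
  case even
  then show ?thesis by (cases n "x - 1" rule: pi_perm_cases) auto
qed auto

lemma pi_perm_permutes: "pi_perm n permutes {1..n}"
proof (rule bij_imp_permutes)
  have r: "pi_perm n x \<in> {1..n}" if "x \<in> {1..n}" for x
    using that by (cases n x rule: pi_perm_cases) (auto elim!: evenE)
  show "bij_betw (pi_perm n) {1..n} {1..n}"
    by (rule bij_betw_byWitness[where f' = "pi_perm n"]) (use pi_perm_involution r in auto)
qed (auto simp: pi_perm_def)

lemma pi_perm_odd: "odd n \<Longrightarrow> pi_perm n = pi_perm (n - 1)"
  by (auto simp: fun_eq_iff pi_perm_def elim!: oddE)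

lemma pi_perm_in_derangements:
  assumes "even n" shows "pi_perm n \<in> derangements n"
proof -
  have "pi_perm n x \<noteq> x" if "x \<in> {1..n}" for x
    using that assms by (cases n x rule: pi_perm_cases) auto
  then show ?thesis
    using pi_perm_permutes[of n] by (auto simp: derangements_def)
qed

lemma pi_perm_in_one_fixpoint_perms:
  assumes "odd n" shows "pi_perm n \<in> one_fixpoint_perms n"
proof -
  have "n \<in> {1..n} \<and> pi_perm n n = n"
    using assms by (cases n n rule: pi_perm_cases) (auto elim!: oddE)
  moreover have "x = n" if "x \<in> {1..n} \<and> pi_perm n x = x" for x
    using assms that by (cases n x rule: pi_perm_cases) auto
  ultimately show ?thesis
    using pi_perm_permutes[of n] unfolding one_fixpoint_perms_def by blast
qed

section \<open>Images of \<open>split_last\<close> on derangements\<close>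

lemma derangements_disjoint_one_fixpoint: "derangements n \<inter> one_fixpoint_perms n = {}"
  unfolding derangements_def one_fixpoint_perms_def by blast

text \<open>The fixed points created are \<open>\<sigma> n\<close> and \<open>n\<close>; passing to
  \<open>{1..n - 1}\<close> discards the second.\<close>

lemma split_last_two_cycle:
  assumes "n \<ge> 1" "\<sigma> \<in> derangements n" "\<sigma> (\<sigma> n) = n"
  shows "split_last n \<sigma> \<in> one_fixpoint_perms (n - 1)"
proof -
  note d = derangementsD[OF assms(2)]
  have "split_last n \<sigma> permutes {1..n - 1}"
    using split_last_permutes[OF d(1) assms(1)] assms(3)
    by (intro permutes_shrink) (simp_all add: split_last_apply)
  moreover have "\<sigma> n \<in> {1..n - 1} \<and> split_last n \<sigma> (\<sigma> n) = \<sigma> n"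
    using d(2,3)[of n] assms(1) by (auto simp: split_last_apply)
  moreover have "x = \<sigma> n" if "x \<in> {1..n - 1} \<and> split_last n \<sigma> x = x" for x
  proof (rule ccontr)
    assume "x \<noteq> \<sigma> n"
    moreover have "\<sigma> x \<noteq> x"
      using that by (intro d(2)) auto
    ultimately show False
      using that by (cases "x = n") (auto simp: split_last_apply)
  qed
  ultimately show ?thesis
    unfolding one_fixpoint_perms_def by blast
qed

text \<open>Here \<open>n\<close> goes to \<open>\<sigma> (\<sigma> n)\<close>, which differs from
  \<open>n\<close>, so \<open>\<sigma> n\<close> is the only fixed point created.\<close>

lemma split_last_long_cycle:
  assumes "n \<ge> 1" "\<sigma> \<in> derangements n" "\<sigma> (\<sigma> n) \<noteq> n"
  shows "split_last n \<sigma> \<in> one_fixpoint_perms n"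
proof -
  note d = derangementsD[OF assms(2)]
  have "\<sigma> n \<in> {1..n} \<and> split_last n \<sigma> (\<sigma> n) = \<sigma> n"
    using d(2,3)[of n] assms(1) by (auto simp: split_last_apply)
  moreover have "x = \<sigma> n" if "x \<in> {1..n} \<and> split_last n \<sigma> x = x" for x
  proof (rule ccontr)
    assume "x \<noteq> \<sigma> n"
    then show False
      using that d(2)[of x] assms(3) by (cases "x = n") (auto simp: split_last_apply)
  qed
  ultimately show ?thesis
    using split_last_permutes[OF d(1) assms(1)] unfolding one_fixpoint_perms_def by blast
qed

lemma one_fixpoint_permsE:
  assumes "\<tau> \<in> one_fixpoint_perms n"
  obtains m where "\<tau> permutes {1..n}" "1 \<le> m" "m \<le> n" "\<tau> m = m"
    "\<And>x. 1 \<le> x \<Longrightarrow> x \<le> n \<Longrightarrow> \<tau> x = x \<Longrightarrow> x = m"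
  using assms unfolding one_fixpoint_perms_def Ex1_def atLeastAtMost_iff by blast

lemma bij_betw_split_last_two_cycle:
  assumes "n \<ge> 1"
  shows "bij_betw (split_last n) {\<sigma> \<in> derangements n. \<sigma> (\<sigma> n) = n} (one_fixpoint_perms (n - 1))"
  unfolding bij_betw_def
proof (intro conjI subset_antisym subsetI)
  fix \<tau> assume "\<tau> \<in> one_fixpoint_perms (n - 1)"
  then obtain m where p: "\<tau> permutes {1..n - 1}" and m: "1 \<le> m" "m \<le> n - 1" "\<tau> m = m"
    and u: "\<And>x. 1 \<le> x \<Longrightarrow> x \<le> n - 1 \<Longrightarrow> \<tau> x = x \<Longrightarrow> x = m"
    by (rule one_fixpoint_permsE) (rule that)
  have "m < n"
    using m(1,2) by simp
  \<comment> \<open>Because \<open>n\<close> is fixed by \<open>\<tau>\<close>, joining it to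
    \<open>m\<close> produces exactly the 2-cycle \<open>(n m)\<close>.\<close>
  moreover from this have "\<tau> n = n"
    by (intro permutes_not_in[OF p]) auto
  moreover have "\<tau> \<circ> transpose n m \<in> derangements n" "split_last n (\<tau> \<circ> transpose n m) = \<tau>"
    using u by (intro join_last permutes_extend[OF p] m \<open>m < n\<close>; simp)+
  ultimately show "\<tau> \<in> split_last n ` {\<sigma> \<in> derangements n. \<sigma> (\<sigma> n) = n}"
    using m(3) by (intro image_eqI[of _ _ "\<tau> \<circ> transpose n m"]) auto
next
  show "inj_on (split_last n) {\<sigma> \<in> derangements n. \<sigma> (\<sigma> n) = n}"
    by (rule inj_on_subset[OF inj_on_split_last[OF assms]]) auto
qed (use split_last_two_cycle assms in auto)

lemma bij_betw_split_last_long_cycle: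
  assumes "n \<ge> 1"
  shows "bij_betw (split_last n) {\<sigma> \<in> derangements n. \<sigma> (\<sigma> n) \<noteq> n} {\<tau> \<in> one_fixpoint_perms n. \<tau> n \<noteq> n}"
  unfolding bij_betw_def
proof (intro conjI subset_antisym subsetI)
  fix \<tau> assume t: "\<tau> \<in> {\<tau> \<in> one_fixpoint_perms n. \<tau> n \<noteq> n}"
  then have "\<tau> \<in> one_fixpoint_perms n" by simp
  then obtain m where p: "\<tau> permutes {1..n}" and m: "1 \<le> m" "m \<le> n" "\<tau> m = m"
    and u: "\<And>x. 1 \<le> x \<Longrightarrow> x \<le> n \<Longrightarrow> \<tau> x = x \<Longrightarrow> x = m"
    by (rule one_fixpoint_permsE) (rule that)
  \<comment> \<open>Since \<open>n\<close> is moved, the fixed point lies below \<open>n\<close>, as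
    \<open>join_last\<close> requires.\<close>
  have "m < n"
    using t m by (cases "m = n") auto
  then have "\<tau> \<circ> transpose n m \<in> derangements n" "split_last n (\<tau> \<circ> transpose n m) = \<tau>"
    using u by (intro join_last p m; simp)+
  then show "\<tau> \<in> split_last n ` {\<sigma> \<in> derangements n. \<sigma> (\<sigma> n) \<noteq> n}"
    using m(3) t by (intro image_eqI[of _ _ "\<tau> \<circ> transpose n m"]) auto
next
  show "inj_on (split_last n) {\<sigma> \<in> derangements n. \<sigma> (\<sigma> n) \<noteq> n}"
    by (rule inj_on_subset[OF inj_on_split_last[OF assms]]) auto
next
  fix \<tau> assume "\<tau> \<in> split_last n ` {\<sigma> \<in> derangements n. \<sigma> (\<sigma> n) \<noteq> n}"
  then show "\<tau> \<in> {\<tau> \<in> one_fixpoint_perms n. \<tau> n \<noteq> n}"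
    using split_last_long_cycle[OF assms] by (auto simp: split_last_apply)
qed


text \<open>
  Identifies the extra point \<open>\<pi>\<^bsub>n-1\<^esub>\<close> of the domain of \<open>\<alpha>\<^bsub>n-1\<^esub>\<close> with the extra point \<open>\<pi>\<^sub>n\<close> of the
  codomain of \<open>\<alpha>\<^sub>n\<close>, for even \<open>n\<close>.
\<close>

definition lift_derangement :: "nat \<Rightarrow> (nat \<Rightarrow> nat) \<Rightarrow> nat \<Rightarrow> nat" where
  "lift_derangement n \<rho> = (if \<rho> \<in> derangements (n - 1) then \<rho> else pi_perm n)"

abbreviation alpha_inv :: "nat \<Rightarrow> (nat \<Rightarrow> nat) \<Rightarrow> nat \<Rightarrow> nat" where
  "alpha_inv n \<equiv> inv_into (alpha_domain n) (alpha n)"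

section \<open>The recursion for \<open>alpha\<close> in terms of \<open>split_last\<close>\<close>

lemma alpha_long_cycle:
  assumes "n \<ge> 2" "\<sigma> \<in> derangements n" "\<sigma> (\<sigma> n) \<noteq> n"
  shows "alpha n \<sigma> = split_last n \<sigma>"
proof -
  obtain k where k: "n = Suc (Suc k)"
    using assms(1) by (metis add_2_eq_Suc le_Suc_ex)
  have "card (orbit \<sigma> n) \<ge> 3"
    using card_orbit_derangement_iff(1)[OF assms(2)] assms by simp
  moreover have "\<sigma> n < n"
    using derangementsD(2,3)[OF assms(2), of n] assms(1) by simp
  ultimately show ?thesis
    using insert_fixpoint_delete_point[OF derangementsD(1)[OF assms(2)] _ assms(3)] assms(2)
    unfolding k alpha.simps(3) by (simp del: alpha.simps)
qed

text \<open>\<open>insert_fixpoint n n \<rho>\<close> is \<open>\<rho>\<close> itself, so the two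
  outcomes of case (ii) are those of \<open>lift_derangement\<close>.\<close>

lemma alpha_two_cycle:
  assumes "n \<ge> 2" "\<sigma> \<in> derangements n" "\<sigma> (\<sigma> n) = n"
  shows "alpha n \<sigma> = lift_derangement n (alpha_inv (n - 1) (split_last n \<sigma>))"
proof -
  obtain k where k: "n = Suc (Suc k)"
    using assms(1) by (metis add_2_eq_Suc le_Suc_ex)
  have "card (orbit \<sigma> n) = 2"
    using card_orbit_derangement_iff(2)[OF assms(2)] assms by simp
  then show ?thesis
    using delete_point_two_cycle[OF derangementsD(1)[OF assms(2)] assms(3)] assms(2)
    unfolding k alpha.simps(3)
    by (simp add: Let_def lift_derangement_def insert_fixpoint_def del: alpha.simps)
qed

lemma pi_perm_odd_fixes: "odd n \<Longrightarrow> pi_perm n n = n"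
  by (cases n n rule: pi_perm_cases) auto

lemma pi_perm_odd_not_derangement: "odd n \<Longrightarrow> pi_perm n \<notin> derangements n"
  using pi_perm_in_one_fixpoint_perms derangements_disjoint_one_fixpoint by blast

lemma alpha_pi_perm_odd:
  assumes "n \<ge> 2" "odd n"
  shows "alpha n (pi_perm n) = alpha_inv (n - 1) (pi_perm (n - 1))"
proof -
  obtain k where k: "n = Suc (Suc k)"
    using assms(1) by (metis add_2_eq_Suc le_Suc_ex)
  show ?thesis
    using assms(2) pi_perm_odd_not_derangement[OF assms(2)]
    unfolding k alpha.simps(3) by (simp add: Let_def insert_fixpoint_def del: alpha.simps)
qed

text \<open>For even \<open>n\<close> the last transposition \<open>(n-1 n)\<close> breaks into two
  fixed points; for odd \<open>n\<close> the transposition in \<open>split_last\<close> is trivial.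
  This lets \<open>pi_perm\<close> be treated like a derangement with a 2-cycle through
  \<open>n\<close>.\<close>

lemma split_last_pi_perm:
  assumes "n \<ge> 2"
  shows "split_last n (pi_perm n) = pi_perm (n - 1)"
proof (cases "even n")
  case True
  have last: "pi_perm n n = n - 1"
    using True assms by (cases n n rule: pi_perm_cases) auto
  show ?thesis
  proof
    fix x
    have "split_last n (pi_perm n) x = (if x = n then n else if x = n - 1 then n - 1 else pi_perm n x)"
      using pi_perm_involution[of n n] last by (simp add: split_last_apply)
    also have "\<dots> = pi_perm (n - 1) x"
      using True assms by (cases n x rule: pi_perm_cases; cases "n - 1" x rule: pi_perm_cases) auto
    finally show "split_last n (pi_perm n) x = pi_perm (n - 1) x" .
  qed
next
  case False
  then show ?thesis
    using pi_perm_odd[of n] pi_perm_odd_fixes[of n] by (simp add: split_last_def)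
qed

text \<open>Describes the part of \<open>one_fixpoint_perms n\<close> not reached from cycles of
  length at least 3, which the short cycles have to supply.\<close>

lemma one_fixpoint_perms_fixing_last:
  assumes "n \<ge> 1"
  shows "\<tau> \<in> one_fixpoint_perms n \<and> \<tau> n = n \<longleftrightarrow> \<tau> \<in> derangements (n - 1)"
proof
  assume t: "\<tau> \<in> one_fixpoint_perms n \<and> \<tau> n = n"
  then have p: "\<tau> permutes {1..n}" and u: "\<exists>!x. x \<in> {1..n} \<and> \<tau> x = x"
    by (auto simp: one_fixpoint_perms_def)
  have "\<tau> x \<noteq> x" if "x \<in> {1..n - 1}" for x
  proof
    assume "\<tau> x = x"
    moreover have "x \<in> {1..n}" "n \<in> {1..n}" "x \<noteq> n"
      using that assms by auto
    ultimately show False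
      using u t by blast
  qed
  then show "\<tau> \<in> derangements (n - 1)"
    using permutes_shrink[OF p] t by (simp add: derangements_def)
next
  assume t: "\<tau> \<in> derangements (n - 1)"
  note d = derangementsD[OF t]
  have "\<tau> n = n"
    using d(4) assms by simp
  moreover have "x = n" if "x \<in> {1..n} \<and> \<tau> x = x" for x
    using d(2)[of x] that by fastforce
  moreover have "n \<in> {1..n}"
    using assms by simp
  ultimately show "\<tau> \<in> one_fixpoint_perms n \<and> \<tau> n = n"
    using permutes_extend[OF d(1)] unfolding one_fixpoint_perms_def by blast
qed

text \<open>Joins cases (ii) and (iii). In case (iii) \<open>n - 1\<close> is even, so bijectivity
  at \<open>n - 1\<close> places the preimage of \<open>pi_perm (n - 1)\<close> among the
  derangements, where \<open>lift_derangement\<close> is the identity.\<close>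

lemma alpha_short_cycle:
  assumes n: "n \<ge> 2" and bij: "bij_betw (alpha (n - 1)) (alpha_domain (n - 1)) (alpha_codomain (n - 1))"
    and s: "\<sigma> \<in> alpha_domain n" "\<sigma> (\<sigma> n) = n"
  shows "alpha n \<sigma> = lift_derangement n (alpha_inv (n - 1) (split_last n \<sigma>))"
proof (cases "\<sigma> \<in> derangements n")
  case True
  then show ?thesis using alpha_two_cycle n s by simp
next
  case False
  then have "odd n" and \<sigma>: "\<sigma> = pi_perm n"
    using s(1) by (auto simp: alpha_domain_def split: if_splits)
  have "alpha_inv (n - 1) (pi_perm (n - 1)) \<in> alpha_domain (n - 1)"
    using bij_betwE[OF bij_betw_inv_into[OF bij]] \<open>odd n\<close> by (simp add: alpha_codomain_def)
  then show ?thesis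
    using \<open>odd n\<close> n alpha_pi_perm_odd[of n] split_last_pi_perm[of n]
    by (simp add: \<sigma> lift_derangement_def alpha_domain_def)
qed

section \<open>Bijectivity of \<open>alpha\<close>\<close>

text \<open>For odd \<open>n\<close> the pair \<open>pi_perm n\<close>,
  \<open>pi_perm (n - 1)\<close> is adjoined to the bijection on 2-cycles. The new value is a
  derangement, hence not already taken.\<close>

lemma bij_betw_split_last_short_cycle:
  assumes "n \<ge> 2"
  shows "bij_betw (split_last n) {\<sigma> \<in> alpha_domain n. \<sigma> (\<sigma> n) = n} (alpha_codomain (n - 1))"
proof (cases "even n")
  case True
  then show ?thesis
    using bij_betw_split_last_two_cycle[of n] assms by (simp add: alpha_domain_def alpha_codomain_def)
next
  case False
  have eq: "{\<sigma> \<in> alpha_domain n. \<sigma> (\<sigma> n) = n} = {\<sigma> \<in> derangements n. \<sigma> (\<sigma> n) = n} \<union> {pi_perm n}"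
    "alpha_codomain (n - 1) = one_fixpoint_perms (n - 1) \<union> {pi_perm (n - 1)}"
    using False pi_perm_odd_fixes[of n] by (auto simp: alpha_domain_def alpha_codomain_def)
  have "pi_perm (n - 1) \<notin> one_fixpoint_perms (n - 1)"
    using pi_perm_in_derangements[of "n - 1"] derangements_disjoint_one_fixpoint[of "n - 1"] False by auto
  then show ?thesis
    unfolding eq using assms split_last_pi_perm[of n]
    by (intro bij_betw_combine bij_betw_split_last_two_cycle) auto
qed

lemma bij_betw_lift_derangement:
  assumes "n \<ge> 2"
  shows "bij_betw (lift_derangement n) (alpha_domain (n - 1))
    (derangements (n - 1) \<union> (if even n then {pi_perm n} else {}))"
proof -
  have id: "bij_betw (lift_derangement n) (derangements (n - 1)) (derangements (n - 1))"
    by (rule bij_betw_cong[THEN iffD1, OF _ bij_betw_id]) (simp add: lift_derangement_def)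
  show ?thesis
  proof (cases "even n")
    case True
    \<comment> \<open>\<open>pi_perm n\<close> moves \<open>n\<close>, whereas derangements of
      \<open>{1..n - 1}\<close> fix it.\<close>
    have "pi_perm n n \<noteq> n"
      using pi_perm_in_derangements[OF True] assms derangementsD(2) by simp
    then have "pi_perm n \<notin> derangements (n - 1)"
      using derangementsD(4)[of "pi_perm n" "n - 1" n] assms by auto
    moreover have "pi_perm (n - 1) \<notin> derangements (n - 1)"
      using pi_perm_odd_not_derangement[of "n - 1"] True assms by simp
    ultimately have "bij_betw (lift_derangement n) (derangements (n - 1) \<union> {pi_perm (n - 1)})
        (derangements (n - 1) \<union> {pi_perm n})"
      by (intro bij_betw_combine id) (auto simp: lift_derangement_def)
    then show ?thesis
      using True assms by (simp add: alpha_domain_def)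
  qed (use id in \<open>simp add: alpha_domain_def\<close>)
qed

text \<open>Two bijections with disjoint images are glued, split by whether
  \<open>\<sigma> (\<sigma> n) = n\<close>. The images are disjoint because those in
  \<open>?E\<close> have one fixed point and move \<open>n\<close>, while those in \<open>?H\<close>
  fix \<open>n\<close> or equal the derangement \<open>pi_perm n\<close>.\<close>

lemma bij_betw_alpha_step:
  assumes n: "n \<ge> 2" and IH: "bij_betw (alpha (n - 1)) (alpha_domain (n - 1)) (alpha_codomain (n - 1))"
  shows "bij_betw (alpha n) (alpha_domain n) (alpha_codomain n)"
proof -
  let ?L = "{\<sigma> \<in> derangements n. \<sigma> (\<sigma> n) \<noteq> n}" and ?S = "{\<sigma> \<in> alpha_domain n. \<sigma> (\<sigma> n) = n}"
  let ?E = "{\<tau> \<in> one_fixpoint_perms n. \<tau> n \<noteq> n}"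
  let ?H = "derangements (n - 1) \<union> (if even n then {pi_perm n} else {})"
  have "bij_betw (split_last n) ?L ?E"
    using n by (intro bij_betw_split_last_long_cycle) simp
  then have L: "bij_betw (alpha n) ?L ?E"
    by (rule bij_betw_cong[THEN iffD1, rotated]) (use alpha_long_cycle n in simp)
  have "bij_betw (lift_derangement n \<circ> (alpha_inv (n - 1) \<circ> split_last n)) ?S ?H"
    using bij_betw_split_last_short_cycle[OF n] bij_betw_inv_into[OF IH] bij_betw_lift_derangement[OF n]
    by (blast intro: bij_betw_trans)
  then have S: "bij_betw (alpha n) ?S ?H"
    by (rule bij_betw_cong[THEN iffD1, rotated]) (use alpha_short_cycle[OF n IH] in simp)
  have last: "\<tau> n = n" if "\<tau> \<in> derangements (n - 1)" for \<tau>
    using derangementsD(4)[OF that, of n] n by simp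
  have "pi_perm n \<notin> one_fixpoint_perms n" if "even n"
    using pi_perm_in_derangements[OF that] derangements_disjoint_one_fixpoint[of n] by auto
  then have "?E \<inter> ?H = {}"
    using last by (auto split: if_splits)
  then have "bij_betw (alpha n) (?L \<union> ?S) (?E \<union> ?H)"
    by (rule bij_betw_combine[OF L S])
  moreover have "?L \<union> ?S = alpha_domain n"
    using pi_perm_odd_fixes[of n] by (auto simp: alpha_domain_def)
  moreover have "?E \<union> ?H = alpha_codomain n"
    using one_fixpoint_perms_fixing_last[of n] n by (auto simp: alpha_codomain_def)
  ultimately show ?thesis
    by simp
qed

lemma bij_betw_alpha: "bij_betw (alpha n) (alpha_domain n) (alpha_codomain n)"
proof (induction n)
  case 0
  have "pi_perm 0 = id"
    by (simp add: fun_eq_iff pi_perm_def)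
  moreover have "derangements 0 = {id}" "one_fixpoint_perms 0 = {}"
    by (auto simp: derangements_def one_fixpoint_perms_def)
  ultimately show ?case
    by (simp add: alpha_domain_def alpha_codomain_def id_def)
next
  case (Suc n)
  show ?case
  \<comment> \<open>Index 1 is checked directly, since the inductive step starts at 2.\<close>
  proof (cases "n = 0")
    case True
    have "pi_perm 1 = id"
      by (simp add: fun_eq_iff pi_perm_def)
    moreover have "derangements 1 = {}" "one_fixpoint_perms 1 = {id}"
      by (auto simp: derangements_def one_fixpoint_perms_def)
    ultimately show ?thesis
      using True by (simp add: alpha_domain_def alpha_codomain_def id_def)
  next
    case False
    then show ?thesis
      using Suc.IH by (intro bij_betw_alpha_step[of "Suc n"]) auto
  qed
qed

section \<open>Explicit preimages and values of \<open>alpha\<close>\<close>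

text \<open>Eliminates \<open>inv_into\<close>: by injectivity a guessed preimage
  \<open>\<rho>\<close> is confirmed by evaluating \<open>alpha (n - 1)\<close> at it.\<close>

lemma alpha_short_cycle_eqI:
  assumes "n \<ge> 2" "\<sigma> \<in> alpha_domain n" "\<sigma> (\<sigma> n) = n"
    and "\<rho> \<in> alpha_domain (n - 1)" "alpha (n - 1) \<rho> = split_last n \<sigma>"
  shows "alpha n \<sigma> = lift_derangement n \<rho>"
proof -
  have "alpha_inv (n - 1) (split_last n \<sigma>) = \<rho>"
    using inv_into_f_f[OF bij_betw_imp_inj_on[OF bij_betw_alpha] assms(4)] assms(5) by simp
  then show ?thesis
    using alpha_short_cycle[OF assms(1) bij_betw_alpha assms(2,3)] by simp
qed

lemma pi_perm_in_alpha_domain: "pi_perm n \<in> alpha_domain n"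
  using pi_perm_in_derangements by (auto simp: alpha_domain_def)

lemma derangements_subset_alpha_domain: "derangements n \<subseteq> alpha_domain n"
  by (auto simp: alpha_domain_def)

text \<open>By induction \<open>pi_perm k\<close> is its own preimage under \<open>alpha k\<close>.
  Lifting it gives \<open>pi_perm (Suc k)\<close>: for even \<open>k\<close> the two coincide as
  functions, for odd \<open>k\<close> it is no derangement and gets replaced.\<close>

lemma alpha_pi_perm: "n \<ge> 1 \<Longrightarrow> alpha n (pi_perm n) = pi_perm n"
proof (induction n rule: nat_induct_at_least)
  case base
  show ?case
    by (simp add: fun_eq_iff pi_perm_def)
next
  case (Suc k)
  have "alpha (Suc k) (pi_perm (Suc k)) = lift_derangement (Suc k) (pi_perm k)"
    using Suc split_last_pi_perm[of "Suc k"]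
    by (intro alpha_short_cycle_eqI) (auto simp: pi_perm_involution pi_perm_in_alpha_domain)
  also have "\<dots> = pi_perm (Suc k)"
    using pi_perm_odd[of "Suc k"] pi_perm_odd_not_derangement[of k]
    by (cases "even k") (simp_all add: lift_derangement_def)
  finally show ?case .
qed


text \<open>The preimage under \<open>alpha (n - 1)\<close> is found by joining \<open>n - 1\<close>
  to the fixed point \<open>\<sigma> n\<close> of \<open>split_last n \<sigma>\<close>. This creates
  a cycle of length at least 3, on which \<open>alpha (n - 1)\<close> merely undoes the
  joining.\<close>

lemma alpha_two_cycle_not_last:
  assumes n: "n \<ge> 2" and s: "\<sigma> \<in> derangements n" "\<sigma> (\<sigma> n) = n" "\<sigma> n \<noteq> n - 1"
  shows "alpha n \<sigma> = split_last n \<sigma> \<circ> transpose (n - 1) (\<sigma> n)"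
proof -
  define \<tau> where "\<tau> = split_last n \<sigma>"
  define \<rho> where "\<rho> = \<tau> \<circ> transpose (n - 1) (\<sigma> n)"
  note d = derangementsD[OF s(1)]
  have a: "1 \<le> \<sigma> n" "\<sigma> n < n - 1" "\<tau> (\<sigma> n) = \<sigma> n"
    using d(2,3)[of n] n s(2,3) by (auto simp: \<tau>_def split_last_apply)
  have "\<tau> \<in> one_fixpoint_perms (n - 1)"
    unfolding \<tau>_def using n s by (intro split_last_two_cycle) auto
  then obtain m where p: "\<tau> permutes {1..n - 1}"
    and u: "\<And>x. 1 \<le> x \<Longrightarrow> x \<le> n - 1 \<Longrightarrow> \<tau> x = x \<Longrightarrow> x = m"
    by (rule one_fixpoint_permsE) (rule that)
  have "m = \<sigma> n"
    using u[of "\<sigma> n"] a by simp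
  then have u': "\<And>x. 1 \<le> x \<Longrightarrow> x < n - 1 \<Longrightarrow> \<tau> x = x \<Longrightarrow> x = \<sigma> n"
    using u by simp
  have ne: "\<tau> (n - 1) \<noteq> n - 1"
  proof
    assume "\<tau> (n - 1) = n - 1"
    then have "n - 1 = m"
      using n by (intro u) auto
    then show False
      using \<open>m = \<sigma> n\<close> s(3) by simp
  qed
  have \<rho>: "\<rho> \<in> derangements (n - 1)" "split_last (n - 1) \<rho> = \<tau>"
    unfolding \<rho>_def by (rule join_last[OF p a u']; assumption)+
  have "\<rho> (\<rho> (n - 1)) \<noteq> n - 1"
    using a(3) ne by (simp add: \<rho>_def)
  then have "alpha (n - 1) \<rho> = \<tau>"
    using \<rho> a by (subst alpha_long_cycle) auto
  then have "alpha n \<sigma> = lift_derangement n \<rho>"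
    using n s \<rho> derangements_subset_alpha_domain
    by (intro alpha_short_cycle_eqI) (auto simp: \<tau>_def)
  then show ?thesis
    using \<rho>(1) by (simp add: lift_derangement_def \<rho>_def \<tau>_def)
qed

text \<open>
  Removing the final transposition \<open>(n-1 n)\<close> reduces the index by two: both steps of the
  recursion merely undo each other, up to gluing \<open>n - 1\<close> to the fixed point \<open>m\<close>.
\<close>

lemma alpha_last_transposition:
  assumes n: "n \<ge> 2" and s: "\<sigma> \<in> derangements n" "\<sigma> n = n - 1" "\<sigma> (n - 1) = n" "\<sigma> \<noteq> pi_perm n"
  defines "\<sigma>' \<equiv> split_last n \<sigma>"
  obtains m where "\<sigma>' \<in> derangements (n - 2)" "\<sigma>' \<noteq> pi_perm (n - 2)"
    "alpha (n - 2) \<sigma>' \<in> one_fixpoint_perms (n - 2)"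
    "1 \<le> m" "m \<le> n - 2" "alpha (n - 2) \<sigma>' m = m"
    "alpha n \<sigma> = alpha (n - 2) \<sigma>' \<circ> transpose (n - 1) m"
proof -
  have "\<sigma>' \<in> one_fixpoint_perms (n - 1)" "\<sigma>' (n - 1) = n - 1"
    unfolding \<sigma>'_def using n s split_last_two_cycle[of n \<sigma>] by (auto simp: split_last_apply)
  then have s': "\<sigma>' \<in> derangements (n - 2)"
    using one_fixpoint_perms_fixing_last[of "n - 1" \<sigma>'] n by (simp add: numeral_2_eq_2)
  \<comment> \<open>For odd \<open>n\<close>, \<open>pi_perm (n - 2)\<close> is no derangement. For
    even \<open>n\<close> it is the image of \<open>pi_perm n\<close> under the injective map
    \<open>split_last n\<close>.\<close>
  have ne: "\<sigma>' \<noteq> pi_perm (n - 2)"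
  proof
    assume eq: "\<sigma>' = pi_perm (n - 2)"
    then have ev: "even n"
      using pi_perm_odd_not_derangement[of "n - 2"] s' n by fastforce
    have "odd (n - 1)" "n - 1 - 1 = n - 2"
      using ev n by simp_all
    then have "\<sigma>' = split_last n (pi_perm n)"
      using eq split_last_pi_perm[OF n] pi_perm_odd[of "n - 1"] by simp
    then have "\<sigma> = pi_perm n"
      using inj_onD[OF inj_on_split_last[of n]] pi_perm_in_derangements[OF ev] s(1) n
      unfolding \<sigma>'_def by simp
    then show False
      using s(4) by simp
  qed
  define \<tau> where "\<tau> = alpha (n - 2) \<sigma>'"
  have dom: "\<sigma>' \<in> alpha_domain (n - 2)"
    using s' derangements_subset_alpha_domain by blast
  \<comment> \<open>Excludes the extra point of the codomain: \<open>alpha (n - 2)\<close> is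
    injective and already sends \<open>pi_perm (n - 2)\<close> to itself. At index 0 the only
    derangement is \<open>pi_perm 0\<close>, excluded by \<open>ne\<close>.\<close>
  have "\<tau> \<noteq> pi_perm (n - 2)"
  proof (cases "n = 2")
    case True
    then show ?thesis
      using s' ne pi_perm_permutes[of 0] by (simp add: derangements_def)
  next
    case False
    then have "alpha (n - 2) (pi_perm (n - 2)) = pi_perm (n - 2)"
      using n by (intro alpha_pi_perm) simp
    then show ?thesis
      unfolding \<tau>_def
      using inj_onD[OF bij_betw_imp_inj_on[OF bij_betw_alpha], of "n - 2" \<sigma>' "pi_perm (n - 2)"]
        dom pi_perm_in_alpha_domain ne by auto
  qed
  moreover have "\<tau> \<in> alpha_codomain (n - 2)"
    unfolding \<tau>_def using bij_betwE[OF bij_betw_alpha] dom by blast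
  ultimately have E: "\<tau> \<in> one_fixpoint_perms (n - 2)"
    by (auto simp: alpha_codomain_def split: if_splits)
  then obtain m where p: "\<tau> permutes {1..n - 2}" and m: "1 \<le> m" "m \<le> n - 2" "\<tau> m = m"
    and u: "\<And>x. 1 \<le> x \<Longrightarrow> x \<le> n - 2 \<Longrightarrow> \<tau> x = x \<Longrightarrow> x = m"
    by (rule one_fixpoint_permsE) (rule that)
  define \<rho> where "\<rho> = \<tau> \<circ> transpose (n - 1) m"
  have p': "\<tau> permutes {1..n - 1}"
    using p by (rule permutes_subset) auto
  have "m < n - 1"
    using m(1,2) by simp
  have u': "x = m" if "1 \<le> x" "x < n - 1" "\<tau> x = x" for x
    using that by (intro u) auto
  have \<rho>: "\<rho> \<in> derangements (n - 1)" "split_last (n - 1) \<rho> = \<tau>"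
    unfolding \<rho>_def by (rule join_last[OF p' m(1) \<open>m < n - 1\<close> m(3) u']; assumption)+
  \<comment> \<open>So \<open>\<rho>\<close> contains the 2-cycle \<open>(n-1 m)\<close>. The
    short-cycle rule therefore applies twice: at \<open>n - 1\<close> with preimage
    \<open>\<sigma>'\<close>, then at \<open>n\<close> with preimage \<open>\<rho>\<close>.\<close>
  have "\<tau> (n - 1) = n - 1"
    using \<open>m < n - 1\<close> by (intro permutes_not_in[OF p]) auto
  then have "\<rho> (\<rho> (n - 1)) = n - 1"
    using m(3) by (simp add: \<rho>_def)
  then have "alpha (n - 1) \<rho> = lift_derangement (n - 1) \<sigma>'"
    using \<rho> m dom derangements_subset_alpha_domain
    by (intro alpha_short_cycle_eqI) (auto simp: \<tau>_def numeral_2_eq_2)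
  also have "\<dots> = \<sigma>'"
    using s' by (simp add: lift_derangement_def numeral_2_eq_2)
  finally have "alpha n \<sigma> = lift_derangement n \<rho>"
    using n s \<rho>(1) derangements_subset_alpha_domain
    by (intro alpha_short_cycle_eqI) (auto simp: \<sigma>'_def)
  then have "alpha n \<sigma> = \<rho>"
    using \<rho>(1) by (simp add: lift_derangement_def)
  then show thesis
    using that s' ne E m by (simp add: \<rho>_def \<tau>_def)
qed

section \<open>Arithmetic progressions and final runs of transpositions\<close>

lemma every_second_iff: "k \<in> every_second a b \<longleftrightarrow> a \<le> k \<and> k \<le> b \<and> even (k - a)"
  by (simp add: every_second_def)

text \<open>All members share the parity of \<open>b\<close>, so one below \<open>b\<close> is at
  most \<open>b - 2\<close>. This peels the last transposition off a run.\<close>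

lemma every_second_drop_last:
  assumes "k \<in> every_second a b" "even (b - a)"
  shows "k = b \<or> k \<in> every_second a (b - 2)"
proof (cases "k = b")
  case False
  have "even (b - k)"
  proof -
    have "(b - k) + (k - a) = b - a"
      using assms(1) by (simp add: every_second_iff)
    then have "even ((b - k) + (k - a))"
      using assms(2) by argo
    then show ?thesis
      using assms(1) unfolding even_add every_second_iff by blast
  qed
  moreover have "0 < b - k"
    using False assms(1) by (simp add: every_second_iff)
  ultimately have "2 \<le> b - k"
    by presburger
  then have "k \<le> b - 2"
    by linarith
  then show ?thesis
    using assms(1) unfolding every_second_iff by blast
qed simp

lemma every_second_step:
  assumes "a \<le> b" "even (b - a)"
  shows "k \<in> every_second a b \<longleftrightarrow> k = b \<or> k \<in> every_second a (b - 2)"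
  using every_second_drop_last[OF _ assms(2), of k] assms by (auto simp: every_second_iff)

definition final_run :: "nat \<Rightarrow> (nat \<Rightarrow> nat) \<Rightarrow> nat \<Rightarrow> bool" where
  "final_run n \<sigma> j \<longleftrightarrow> 1 \<le> j \<and> j \<le> n + 1 \<and> j mod 2 = (n + 1) mod 2 \<and>
     (\<forall>k\<in>every_second j (n - 1). is_2cycle_of \<sigma> k (k + 1))"

lemma run_start_eq: "run_start n \<sigma> = (LEAST j. final_run n \<sigma> j)"
  by (simp add: run_start_def final_run_def)

lemma final_run_empty: "n \<ge> 1 \<Longrightarrow> final_run n \<sigma> (n + 1)"
  by (auto simp: final_run_def every_second_iff)

text \<open>A smaller start of the right parity is at most \<open>n - 1\<close>, and its progression
  then ends in \<open>n - 1\<close>, which would make \<open>(n-1 n)\<close> a cycle.\<close>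

lemma run_start_empty:
  assumes "n \<ge> 2" "\<not> (\<sigma> (n - 1) = n \<and> \<sigma> n = n - 1)"
  shows "run_start n \<sigma> = n + 1"
  unfolding run_start_eq
proof (rule Least_equality)
  fix j assume j: "final_run n \<sigma> j"
  show "n + 1 \<le> j"
  proof (rule ccontr)
    assume "\<not> n + 1 \<le> j"
    moreover have "even j \<longleftrightarrow> odd n" "1 \<le> j"
      using j by (auto simp: final_run_def mod2_eq_if split: if_splits)
    ultimately have "j \<le> n - 1"
      using assms(1) by (cases "j = n") auto
    moreover from this have "even (n - 1 - j)"
      using \<open>even j \<longleftrightarrow> odd n\<close> assms(1) by simp
    ultimately have "n - 1 \<in> every_second j (n - 1)"
      by (simp only: every_second_iff order_refl simp_thms)
    then have "is_2cycle_of \<sigma> (n - 1) (n - 1 + 1)"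
      using j by (simp only: final_run_def)
    then show False
      using assms by (simp add: is_2cycle_of_def)
  qed
qed (use assms final_run_empty in auto)

text \<open>Apart from \<open>(n-1 n)\<close>, the pairs of the run lie in
  \<open>{1..n - 2}\<close>, where both functions agree. The bound on \<open>j\<close> sets aside
  the empty run \<open>n + 1\<close>, admissible for \<open>n\<close> but too large for
  \<open>n - 2\<close>.\<close>

lemma final_run_last_transposition:
  assumes "n \<ge> 3" "\<sigma> (n - 1) = n" "\<sigma> n = n - 1"
    and "\<And>x. 1 \<le> x \<Longrightarrow> x \<le> n - 2 \<Longrightarrow> \<sigma>' x = \<sigma> x" and "j \<le> n - 1"
  shows "final_run n \<sigma> j \<longleftrightarrow> final_run (n - 2) \<sigma>' j"
proof -
  have mod: "(n + 1) mod 2 = (n - 2 + 1) mod 2"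
    using assms(1) by (simp add: mod2_eq_if)
  have "(\<forall>k\<in>every_second j (n - 1). is_2cycle_of \<sigma> k (k + 1)) \<longleftrightarrow>
      (\<forall>k\<in>every_second j (n - 2 - 1). is_2cycle_of \<sigma>' k (k + 1))"
    if "1 \<le> j" "j mod 2 = (n + 1) mod 2"
  proof -
    have mem: "k \<in> every_second j (n - 1) \<longleftrightarrow> k = n - 1 \<or> k \<in> every_second j (n - 2 - 1)" for k
    proof -
      have "even j \<longleftrightarrow> odd n"
        using that(2) by (simp add: mod2_eq_if split: if_splits)
      then have "even (n - 1 - j)"
        using assms(1,5) by simp
      moreover have "n - 1 - 2 = n - 2 - 1"
        by simp
      ultimately show ?thesis
        using every_second_step[OF assms(5), of k] by metis
    qed
    have last: "is_2cycle_of \<sigma> (n - 1) (n - 1 + 1)"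
      using assms(1-3) by (simp add: is_2cycle_of_def)
    have rest: "is_2cycle_of \<sigma> k (k + 1) \<longleftrightarrow> is_2cycle_of \<sigma>' k (k + 1)"
      if "k \<in> every_second j (n - 2 - 1)" for k
    proof -
      have "1 \<le> k" "k + 1 \<le> n - 2"
        using that \<open>1 \<le> j\<close> assms(1) unfolding every_second_iff by linarith+
      then show ?thesis
        using assms(4)[of k] assms(4)[of "k + 1"] by (simp add: is_2cycle_of_def)
    qed
    have "every_second j (n - 1) = insert (n - 1) (every_second j (n - 2 - 1))"
      using mem by blast
    then show ?thesis
      using last rest by (metis insert_iff)
  qed
  then show ?thesis
    using mod assms(1,5) unfolding final_run_def by auto
qed

text \<open>The empty run for \<open>n - 2\<close> starts at \<open>n - 1\<close>, so its least
  start falls in the range where both predicates agree.\<close>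

lemma run_start_last_transposition:
  assumes "n \<ge> 3" "\<sigma> (n - 1) = n" "\<sigma> n = n - 1"
    and "\<And>x. 1 \<le> x \<Longrightarrow> x \<le> n - 2 \<Longrightarrow> \<sigma>' x = \<sigma> x"
  shows "run_start n \<sigma> = run_start (n - 2) \<sigma>'"
proof -
  note iff = final_run_last_transposition[OF assms]
  have ex: "final_run (n - 2) \<sigma>' (n - 1)"
  proof -
    have "n - 2 + 1 = n - 1" "1 \<le> n - 2"
      using assms(1) by simp_all
    then show ?thesis
      using final_run_empty[of "n - 2" \<sigma>'] by metis
  qed
  let ?j = "LEAST j. final_run (n - 2) \<sigma>' j"
  have j: "final_run (n - 2) \<sigma>' ?j" "?j \<le> n - 1"
    using LeastI[of "final_run (n - 2) \<sigma>'", OF ex] Least_le[of "final_run (n - 2) \<sigma>'", OF ex] by auto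
  show ?thesis
    unfolding run_start_eq
  proof (rule Least_equality)
    show "final_run n \<sigma> ?j"
      using iff j by blast
    fix y assume y: "final_run n \<sigma> y"
    show "?j \<le> y"
    proof (cases "y \<le> n - 1")
      case True
      then show ?thesis
        using iff y by (blast intro: Least_le)
    qed (use j in auto)
  qed
qed

text \<open>The following two predicates are Case 1 and Case 2 of the theorem, with \<open>j\<close> a free parameter.\<close>

definition merge_formula :: "nat \<Rightarrow> nat \<Rightarrow> (nat \<Rightarrow> nat) \<Rightarrow> (nat \<Rightarrow> nat) \<Rightarrow> bool" where
  "merge_formula n j \<sigma> \<tau> \<longleftrightarrow> (let a = \<sigma> (j - 1); b = \<sigma> (j - 2) in
     3 \<le> j \<and> \<tau> (j - 2) = a \<and> \<tau> a = b \<and>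
     (\<forall>x. 1 \<le> x \<and> x < j - 1 \<and> x \<notin> {j - 2, a} \<longrightarrow> \<tau> x = \<sigma> x) \<and>
     (\<forall>k\<in>every_second (j - 1) (n - 2). \<tau> k = k + 1 \<and> \<tau> (k + 1) = k) \<and>
     \<tau> n = n)"

definition split_formula :: "nat \<Rightarrow> nat \<Rightarrow> (nat \<Rightarrow> nat) \<Rightarrow> (nat \<Rightarrow> nat) \<Rightarrow> bool" where
  "split_formula n j \<sigma> \<tau> \<longleftrightarrow> (let a = \<sigma> (j - 1); b = \<sigma> a in
     \<tau> (j - 1) = b \<and>
     (\<forall>x. 1 \<le> x \<and> x < j \<and> x \<notin> {j - 1, a} \<longrightarrow> \<tau> x = \<sigma> x) \<and>
     (j = n + 1 \<longrightarrow> \<tau> a = a) \<and>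
     (j \<le> n - 1 \<longrightarrow>
       \<tau> j = a \<and> \<tau> a = j \<and>
       (\<forall>k\<in>every_second (j + 1) (n - 2). \<tau> k = k + 1 \<and> \<tau> (k + 1) = k) \<and>
       \<tau> n = n))"

section \<open>Base cases and steps of the closed formula\<close>

text \<open>With an empty run, \<open>j - 1\<close> is \<open>n\<close> and \<open>j - 2\<close> is
  \<open>n - 1\<close>. Composing with \<open>(n-1 a)\<close> inserts \<open>a\<close> between
  \<open>n - 1\<close> and its old image \<open>b\<close>.\<close>

lemma merge_formula_base:
  assumes "n \<ge> 2" "\<sigma> \<in> derangements n" "\<sigma> (\<sigma> n) = n" "\<sigma> n \<noteq> n - 1"
  shows "merge_formula n (n + 1) \<sigma> (alpha n \<sigma>)"
proof -
  note d = derangementsD[OF assms(2)]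
  have a: "1 \<le> \<sigma> n" "\<sigma> n < n - 1"
    using d(2,3)[of n] assms(1,4) by auto
  have ne: "n - 1 \<noteq> n" "n \<noteq> n - 1" "\<sigma> n \<noteq> n" "n \<noteq> \<sigma> n" "\<sigma> n \<noteq> n - 1" "n - 1 \<noteq> \<sigma> n"
    using a by auto
  have al: "alpha n \<sigma> x = split_last n \<sigma> (transpose (n - 1) (\<sigma> n) x)" for x
    using alpha_two_cycle_not_last[OF assms] by simp
  have "alpha n \<sigma> (n - 1) = \<sigma> n" "alpha n \<sigma> (\<sigma> n) = \<sigma> (n - 1)" "alpha n \<sigma> n = n"
    using assms(3) ne unfolding al by (simp_all add: split_last_apply transpose_def)
  moreover have "alpha n \<sigma> x = \<sigma> x" if "x < n" "x \<noteq> n - 1" "x \<noteq> \<sigma> n" for x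
    using that unfolding al by (simp add: split_last_apply transpose_def)
  moreover have "every_second n (n - 2) = {}"
    using assms(1) by (auto simp: every_second_iff)
  ultimately show ?thesis
    using assms(1) by (simp add: merge_formula_def numeral_2_eq_2 numeral_3_eq_3)
qed

lemma split_formula_base:
  assumes "n \<ge> 2" "\<sigma> \<in> derangements n" "\<sigma> (\<sigma> n) \<noteq> n"
  shows "split_formula n (n + 1) \<sigma> (alpha n \<sigma>)"
proof -
  have "\<sigma> n \<noteq> n" "\<sigma> n \<noteq> Suc n" "Suc n \<noteq> \<sigma> n"
    using derangementsD(2,3)[OF assms(2), of n] assms(1) by auto
  then show ?thesis
    using alpha_long_cycle[OF assms] assms(1)
    by (auto simp: split_formula_def split_last_apply Let_def)
qed

text \<open>The formula at \<open>n - 2\<close> makes \<open>n - 2\<close> the fixed point, so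
  joining \<open>n - 1\<close> to it appends \<open>(n-2 n-1)\<close> to the shifted run and leaves
  \<open>n\<close> fixed.\<close>

lemma merge_formula_step:
  assumes F: "merge_formula (n - 2) j \<sigma>' \<tau>'"
    and n: "n \<ge> 4" and j: "j \<le> n - 1" "even (n - 1 - j)"
    and inj: "inj \<sigma>"
    and eq: "\<And>x. 1 \<le> x \<Longrightarrow> x \<le> n - 2 \<Longrightarrow> \<sigma>' x = \<sigma> x"
    and out: "\<tau>' (n - 1) = n - 1" "\<tau>' n = n"
  shows "merge_formula n j \<sigma> (\<tau>' \<circ> transpose (n - 1) (n - 2))"
proof -
  let ?\<tau> = "\<tau>' \<circ> transpose (n - 1) (n - 2)"
  have "3 \<le> j"
    using F by (simp add: merge_formula_def Let_def)
  then have s: "\<sigma>' (j - 1) = \<sigma> (j - 1)" "\<sigma>' (j - 2) = \<sigma> (j - 2)"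
    using j(1) by (auto intro!: eq)
  let ?a = "\<sigma> (j - 1)"
  have F': "\<tau>' (j - 2) = ?a" "\<tau>' ?a = \<sigma> (j - 2)"
    "\<And>x. 1 \<le> x \<Longrightarrow> x < j - 1 \<Longrightarrow> x \<noteq> j - 2 \<Longrightarrow> x \<noteq> ?a \<Longrightarrow> \<tau>' x = \<sigma>' x"
    "\<And>k. k \<in> every_second (j - 1) (n - 2 - 2) \<Longrightarrow> \<tau>' k = k + 1 \<and> \<tau>' (k + 1) = k"
    "\<tau>' (n - 2) = n - 2"
    using F unfolding merge_formula_def Let_def s by auto
  have \<tau>: "?\<tau> x = (if x = n - 1 then n - 2 else if x = n - 2 then n - 1 else \<tau>' x)" for x
    using F'(5) out(1) n by (simp add: transpose_def)
  \<comment> \<open>A fixed point \<open>a\<close> of \<open>\<tau>'\<close> would give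
    \<open>b = a\<close>, against injectivity of \<open>\<sigma>\<close>.\<close>
  have "?a \<noteq> n - 2"
  proof
    assume "?a = n - 2"
    then have "\<sigma> (j - 2) = \<sigma> (j - 1)"
      using F'(2,5) by simp
    then show False
      using injD[OF inj] \<open>3 \<le> j\<close> by fastforce
  qed
  moreover have "?a \<noteq> n - 1"
  proof
    assume "?a = n - 1"
    then have "\<sigma> (j - 2) = \<sigma> (j - 1)"
      using F'(2) out(1) by simp
    then show False
      using injD[OF inj] \<open>3 \<le> j\<close> by fastforce
  qed
  ultimately have "?\<tau> ?a = \<sigma> (j - 2)"
    using F'(2) unfolding \<tau> by simp
  moreover have "?\<tau> (j - 2) = ?a"
    using F'(1) j(1) \<open>3 \<le> j\<close> unfolding \<tau> by auto
  moreover have "?\<tau> x = \<sigma> x" if "1 \<le> x" "x < j - 1" "x \<noteq> j - 2" "x \<noteq> ?a" for x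
  proof -
    have "x \<le> n - 2" "x \<noteq> n - 1" "x \<noteq> n - 2"
      using that j(1) by linarith+
    then show ?thesis
      using F'(3)[OF that] eq[of x] that unfolding \<tau> by simp
  qed
  moreover have "?\<tau> k = k + 1 \<and> ?\<tau> (k + 1) = k" if k: "k \<in> every_second (j - 1) (n - 2)" for k
  proof -
    have "n - 2 - (j - 1) = n - 1 - j"
      using \<open>3 \<le> j\<close> by simp
    then consider "k = n - 2" | "k \<in> every_second (j - 1) (n - 2 - 2)"
      using every_second_drop_last[OF k] j(2) by metis
    then show ?thesis
    proof cases
      case 1
      then have "k + 1 = n - 1" "k \<noteq> n - 1"
        using n by simp_all
      then show ?thesis
        using 1 unfolding \<tau> by simp
    next
      case 2
      then have "k \<le> n - 4"
        by (simp add: every_second_iff)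
      then have "k \<noteq> n - 1" "k \<noteq> n - 2" "k + 1 \<noteq> n - 1" "k + 1 \<noteq> n - 2"
        using n by linarith+
      then show ?thesis
        using F'(4)[OF 2] unfolding \<tau> by simp
    qed
  qed
  moreover have "?\<tau> n = n"
  proof -
    have "n \<noteq> n - 1" "n \<noteq> n - 2"
      using n by auto
    then show ?thesis
      using out(2) unfolding \<tau> by simp
  qed
  ultimately show ?thesis
    using \<open>3 \<le> j\<close> unfolding merge_formula_def Let_def by blast
qed

text \<open>
  Here \<open>(n-1 n)\<close> is the whole final run, so the fixed point of \<open>\<tau>'\<close> is \<open>a\<close>; otherwise it is \<open>n - 2\<close>.
\<close>

lemma split_formula_step_first:
  assumes F: "split_formula (n - 2) (n - 1) \<sigma>' \<tau>'"
    and n: "n \<ge> 3"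
    and eq: "\<And>x. 1 \<le> x \<Longrightarrow> x \<le> n - 2 \<Longrightarrow> \<sigma>' x = \<sigma> x"
    and a: "1 \<le> \<sigma> (n - 2)" "\<sigma> (n - 2) < n - 2"
    and out: "\<tau>' (n - 1) = n - 1" "\<tau>' n = n"
  shows "split_formula n (n - 1) \<sigma> (\<tau>' \<circ> transpose (n - 1) (\<sigma> (n - 2)))"
proof -
  let ?a = "\<sigma> (n - 2)"
  let ?\<tau> = "\<tau>' \<circ> transpose (n - 1) ?a"
  have s: "n - 1 - 1 = n - 2" "\<sigma>' (n - 2) = ?a" "\<sigma>' ?a = \<sigma> ?a"
    using n a eq by simp_all
  \<comment> \<open>Since \<open>n - 1\<close> is \<open>n - 2 + 1\<close>, the empty-run clause of
    \<open>F\<close> applies and makes \<open>a\<close> a fixed point.\<close>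
  have F': "\<tau>' (n - 2) = \<sigma> ?a" "\<tau>' ?a = ?a"
    "\<And>x. 1 \<le> x \<Longrightarrow> x < n - 1 \<Longrightarrow> x \<noteq> n - 2 \<Longrightarrow> x \<noteq> ?a \<Longrightarrow> \<tau>' x = \<sigma>' x"
    using F n unfolding split_formula_def Let_def s by auto
  have \<tau>: "?\<tau> x = (if x = n - 1 then ?a else if x = ?a then n - 1 else \<tau>' x)" for x
    using F'(2) out(1) by (simp add: transpose_def)
  have "?\<tau> (n - 2) = \<sigma> ?a" "?\<tau> (n - 1) = ?a" "?\<tau> ?a = n - 1" "?\<tau> n = n"
    using F'(1) out(2) n a unfolding \<tau> by auto
  moreover have "?\<tau> x = \<sigma> x" if "1 \<le> x" "x < n - 1" "x \<noteq> n - 2" "x \<noteq> ?a" for x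
    using F'(3)[OF that] eq[of x] that unfolding \<tau> by simp
  moreover have "every_second (n - 1 + 1) (n - 2) = {}"
    using n by (auto simp: every_second_iff)
  moreover have "n - 1 \<noteq> n + 1"
    by simp
  ultimately show ?thesis
    unfolding split_formula_def Let_def s by blast
qed

text \<open>With at least two transpositions in the run, \<open>n - 2\<close> is already the fixed
  point of \<open>\<tau>'\<close>, and \<open>(n-2 n-1)\<close> is appended as in the merging
  case.\<close>

lemma split_formula_step:
  assumes F: "split_formula (n - 2) j \<sigma>' \<tau>'"
    and n: "n \<ge> 4" and j: "2 \<le> j" "j \<le> n - 3" "even (n - 1 - j)"
    and eq: "\<And>x. 1 \<le> x \<Longrightarrow> x \<le> n - 2 \<Longrightarrow> \<sigma>' x = \<sigma> x"
    and a: "1 \<le> \<sigma> (j - 1)" "\<sigma> (j - 1) \<le> n - 2"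
    and out: "\<tau>' (n - 1) = n - 1" "\<tau>' n = n"
  shows "split_formula n j \<sigma> (\<tau>' \<circ> transpose (n - 1) (n - 2))"
proof -
  let ?\<tau> = "\<tau>' \<circ> transpose (n - 1) (n - 2)"
  let ?a = "\<sigma> (j - 1)"
  have s: "\<sigma>' (j - 1) = ?a" "\<sigma>' ?a = \<sigma> ?a"
    using j a by (auto intro!: eq)
  have jn: "j \<le> n - 2 - 1" "n - 2 - 1 = n - 3"
    using j by simp_all
  have F': "\<tau>' (j - 1) = \<sigma> ?a" "\<tau>' j = ?a" "\<tau>' ?a = j"
    "\<And>x. 1 \<le> x \<Longrightarrow> x < j \<Longrightarrow> x \<noteq> j - 1 \<Longrightarrow> x \<noteq> ?a \<Longrightarrow> \<tau>' x = \<sigma>' x"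
    "\<And>k. k \<in> every_second (j + 1) (n - 2 - 2) \<Longrightarrow> \<tau>' k = k + 1 \<and> \<tau>' (k + 1) = k"
    "\<tau>' (n - 2) = n - 2"
    using F jn(1) unfolding split_formula_def Let_def s by auto
  have \<tau>: "?\<tau> x = (if x = n - 1 then n - 2 else if x = n - 2 then n - 1 else \<tau>' x)" for x
    using F'(6) out(1) n by (simp add: transpose_def)
  \<comment> \<open>\<open>\<tau>'\<close> sends \<open>a\<close> to \<open>j\<close>, which is
    below \<open>n - 2\<close>, but fixes \<open>n - 2\<close>.\<close>
  have "?a \<noteq> n - 2"
    using F'(3,6) j n by auto
  then have "?\<tau> ?a = j"
    using F'(3) a n unfolding \<tau> by auto
  moreover have "?\<tau> (j - 1) = \<sigma> ?a" "?\<tau> j = ?a" "?\<tau> n = n"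
    using F'(1,2) out(2) j n unfolding \<tau> by auto
  moreover have "?\<tau> x = \<sigma> x" if "1 \<le> x" "x < j" "x \<noteq> j - 1" "x \<noteq> ?a" for x
  proof -
    have "x \<le> n - 2" "x \<noteq> n - 1" "x \<noteq> n - 2"
      using that j(2) by linarith+
    then show ?thesis
      using F'(4)[OF that] eq[of x] that unfolding \<tau> by simp
  qed
  moreover have "?\<tau> k = k + 1 \<and> ?\<tau> (k + 1) = k" if k: "k \<in> every_second (j + 1) (n - 2)" for k
  proof -
    have "n - 1 - j = n - 2 - (j + 1) + 2"
      using j(2) n by simp
    then have "even (n - 2 - (j + 1))"
      using j(3) by simp
    then consider "k = n - 2" | "k \<in> every_second (j + 1) (n - 2 - 2)"
      using every_second_drop_last[OF k] by blast
    then show ?thesis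
    proof cases
      case 1
      then have "k + 1 = n - 1" "k \<noteq> n - 1"
        using n by simp_all
      then show ?thesis
        using 1 unfolding \<tau> by simp
    next
      case 2
      then have "k \<le> n - 4"
        by (simp add: every_second_iff)
      then have "k \<noteq> n - 1" "k \<noteq> n - 2" "k + 1 \<noteq> n - 1" "k + 1 \<noteq> n - 2"
        using n by linarith+
      then show ?thesis
        using F'(5)[OF 2] unfolding \<tau> by simp
    qed
  qed
  moreover have "j \<noteq> n + 1"
    using j(2) by simp
  ultimately show ?thesis
    unfolding split_formula_def Let_def by blast
qed

section \<open>Assembly of the closed formula\<close>

lemma run_start_bounds:
  assumes "n \<ge> 1"
  shows "1 \<le> run_start n \<sigma>" "run_start n \<sigma> \<le> n + 1" "even (n + 1 - run_start n \<sigma>)"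
proof -
  have "final_run n \<sigma> (run_start n \<sigma>)"
    unfolding run_start_eq by (rule LeastI) (rule final_run_empty[OF assms])
  then have "1 \<le> run_start n \<sigma>" "run_start n \<sigma> \<le> n + 1"
    and m: "run_start n \<sigma> mod 2 = (n + 1) mod 2"
    by (auto simp: final_run_def)
  then show "1 \<le> run_start n \<sigma>" "run_start n \<sigma> \<le> n + 1" "even (n + 1 - run_start n \<sigma>)"
    by (simp_all only: even_diff_nat even_add) (metis even_iff_mod_2_eq_zero even_add m)
qed

text \<open>Strong induction that removes a final \<open>(n-1 n)\<close>: \<open>run_start\<close>
  and the case distinction carry over to \<open>\<sigma>'\<close> at index \<open>n - 2\<close>. If
  there is no such transposition, the run is empty and the base formulas apply.\<close>

lemma alpha_formula:
  assumes "n \<ge> 1" "\<sigma> \<in> derangements n" "\<sigma> \<noteq> pi_perm n"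
  shows "2 \<le> run_start n \<sigma> \<and>
    (if \<sigma> (\<sigma> (run_start n \<sigma> - 1)) = run_start n \<sigma> - 1
     then merge_formula n (run_start n \<sigma>) \<sigma> (alpha n \<sigma>)
     else split_formula n (run_start n \<sigma>) \<sigma> (alpha n \<sigma>))"
  using assms
proof (induction n arbitrary: \<sigma> rule: less_induct)
  case (less n)
  note d = derangementsD[OF less.prems(2)]
  have n: "n \<ge> 2"
    using d(2,3)[of n] less.prems(1) by (cases "n = 1") auto
  show ?case
  proof (cases "\<sigma> (n - 1) = n \<and> \<sigma> n = n - 1")
    case False
    then have j: "run_start n \<sigma> = n + 1"
      by (rule run_start_empty[OF n])
    have "\<sigma> n \<noteq> n - 1" if "\<sigma> (\<sigma> n) = n"
      using False that by auto
    then show ?thesis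
      using merge_formula_base[OF n less.prems(2)] split_formula_base[OF n less.prems(2)] n
      unfolding j by auto
  next
    case True
    define \<sigma>' where "\<sigma>' = split_last n \<sigma>"
    define \<tau>' where "\<tau>' = alpha (n - 2) \<sigma>'"
    obtain m where s': "\<sigma>' \<in> derangements (n - 2)" "\<sigma>' \<noteq> pi_perm (n - 2)"
      and E: "\<tau>' \<in> one_fixpoint_perms (n - 2)"
      and m: "1 \<le> m" "m \<le> n - 2" "\<tau>' m = m"
      and alpha: "alpha n \<sigma> = \<tau>' \<circ> transpose (n - 1) m"
      using alpha_last_transposition[OF n less.prems(2) conjunct2[OF True] conjunct1[OF True] less.prems(3)]
      unfolding \<sigma>'_def \<tau>'_def by metis
    note d' = derangementsD[OF s'(1)]
    have "n \<ge> 3"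
      using m by simp
    \<comment> \<open>Index \<open>n - 2 = 1\<close> is impossible, as \<open>{1..1}\<close> has no
      derangement.\<close>
    moreover have "n \<noteq> 3"
      using d'(2)[of 1] d'(3)[of 1] by auto
    ultimately have n4: "n \<ge> 4"
      by simp
    have eq: "\<sigma>' x = \<sigma> x" if "1 \<le> x" "x \<le> n - 2" for x
      using that True by (auto simp: \<sigma>'_def split_last_apply)
    have p: "\<tau>' permutes {1..n - 2}"
      using E by (simp add: one_fixpoint_perms_def)
    have out: "\<tau>' (n - 1) = n - 1" "\<tau>' n = n"
      using n by (auto intro!: permutes_not_in[OF p])
    \<comment> \<open>Used to identify \<open>m\<close> with whatever fixed point the inductive
      formula exhibits.\<close>
    have uniq: "x = m" if "1 \<le> x" "x \<le> n - 2" "\<tau>' x = x" for x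
      using one_fixpoint_permsE[OF E] that m by metis
    define j where "j = run_start n \<sigma>"
    have j': "run_start (n - 2) \<sigma>' = j"
      unfolding j_def using run_start_last_transposition[OF \<open>n \<ge> 3\<close> _ _ eq] True by simp
    have "2 \<le> j" and IH: "if \<sigma>' (\<sigma>' (j - 1)) = j - 1
        then merge_formula (n - 2) j \<sigma>' \<tau>' else split_formula (n - 2) j \<sigma>' \<tau>'"
    proof -
      have "n - 2 < n" "1 \<le> n - 2"
        using n4 by simp_all
      note IH = less.IH[OF this s', unfolded j', folded \<tau>'_def]
      show "2 \<le> j" "if \<sigma>' (\<sigma>' (j - 1)) = j - 1
          then merge_formula (n - 2) j \<sigma>' \<tau>' else split_formula (n - 2) j \<sigma>' \<tau>'"
        by (rule conjunct1[OF IH], rule conjunct2[OF IH])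
    qed
    have jn: "j \<le> n - 1" "even (n - 1 - j)"
    proof -
      have e: "n - 2 + 1 = n - 1" "1 \<le> n - 2"
        using n4 by simp_all
      show "j \<le> n - 1" "even (n - 1 - j)"
        using run_start_bounds(2,3)[OF e(2), of \<sigma>'] unfolding j' e(1) by blast+
    qed
    have a: "\<sigma>' (j - 1) = \<sigma> (j - 1)" "1 \<le> \<sigma> (j - 1)" "\<sigma> (j - 1) \<le> n - 2" "\<sigma> (j - 1) \<noteq> j - 1"
      using eq[of "j - 1"] d'(2,3)[of "j - 1"] \<open>2 \<le> j\<close> jn(1) by auto
    have a': "\<sigma>' (\<sigma>' (j - 1)) = \<sigma> (\<sigma> (j - 1))"
      using eq a by simp
    show ?thesis
    proof (cases "\<sigma> (\<sigma> (j - 1)) = j - 1")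
      case True
      then have F: "merge_formula (n - 2) j \<sigma>' \<tau>'"
        using IH a' by simp
      then have "m = n - 2"
        using uniq[of "n - 2"] n4 by (simp add: merge_formula_def Let_def)
      moreover have "inj \<sigma>"
        using d(1) by (rule permutes_inj)
      ultimately have "merge_formula n j \<sigma> (alpha n \<sigma>)"
        using merge_formula_step[OF F n4 jn _ eq out] alpha by simp
      then show ?thesis
        using True \<open>2 \<le> j\<close> by (simp add: j_def)
    next
      case False
      then have F: "split_formula (n - 2) j \<sigma>' \<tau>'"
        using IH a' by simp
      have "split_formula n j \<sigma> (alpha n \<sigma>)"
      proof (cases "j = n - 1")
        case True
        have "j - 1 = n - 2" "j = n - 2 + 1"
          using True n4 by simp_all
        then have "\<tau>' (\<sigma> (j - 1)) = \<sigma> (j - 1)"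
          using F a(1) unfolding split_formula_def Let_def by metis
        then have "m = \<sigma> (n - 2)"
          using uniq[of "\<sigma> (j - 1)"] a \<open>j - 1 = n - 2\<close> by simp
        moreover have "\<sigma> (n - 2) < n - 2"
          using a(3,4) \<open>j - 1 = n - 2\<close> by simp
        ultimately show ?thesis
          using split_formula_step_first[OF _ \<open>n \<ge> 3\<close> eq _ _ out] F a(2) alpha True \<open>j - 1 = n - 2\<close>
          by simp
      next
        case False
        \<comment> \<open>\<open>j\<close> has the parity of \<open>n - 1\<close>, so the next
          smaller value is \<open>n - 3\<close>.\<close>
        then have jn3: "j \<le> n - 3"
          using jn by presburger
        then have "\<tau>' (n - 2) = n - 2"
          using F n4 by (simp add: split_formula_def Let_def)
        then have "m = n - 2"
          using uniq[of "n - 2"] n4 by simp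
        then show ?thesis
          using split_formula_step[OF F n4 \<open>2 \<le> j\<close> jn3 jn(2) eq a(2,3) out] alpha by simp
      qed
      then show ?thesis
        using False \<open>2 \<le> j\<close> by (simp add: j_def)
    qed
  qed
qed

theorem theorem1:
  fixes n :: nat
  assumes "n \<ge> 1"
  shows "alpha n (pi_perm n) = pi_perm n \<and>
    (\<forall>\<sigma>\<in>derangements n. \<sigma> \<noteq> pi_perm n \<longrightarrow>
      (let j = run_start n \<sigma>; a = \<sigma> (j - 1); \<tau> = alpha n \<sigma> in
        2 \<le> j \<and>
        \<tau> permutes {1..n} \<and>
        (\<sigma> a = j - 1 \<longrightarrow>
          (let b = \<sigma> (j - 2) in
            3 \<le> j \<and>
            \<tau> (j - 2) = a \<and>
            \<tau> a = b \<and>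
            (\<forall>x. 1 \<le> x \<and> x < j - 1 \<and> x \<notin> {j - 2, a} \<longrightarrow> \<tau> x = \<sigma> x) \<and>
            (\<forall>k\<in>every_second (j - 1) (n - 2). \<tau> k = k + 1 \<and> \<tau> (k + 1) = k) \<and>
            \<tau> n = n)) \<and>
        (\<sigma> a \<noteq> j - 1 \<longrightarrow>
          (let b = \<sigma> a in
            \<tau> (j - 1) = b \<and>
            (\<forall>x. 1 \<le> x \<and> x < j \<and> x \<notin> {j - 1, a} \<longrightarrow> \<tau> x = \<sigma> x) \<and>
            (j = n + 1 \<longrightarrow> \<tau> a = a) \<and>
            (j \<le> n - 1 \<longrightarrow>
              \<tau> j = a \<and>
              \<tau> a = j \<and>
              (\<forall>k\<in>every_second (j + 1) (n - 2). \<tau> k = k + 1 \<and> \<tau> (k + 1) = k) \<and>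
              \<tau> n = n)))))"
proof -
  \<comment> \<open>The pointwise formulas do not provide this; it follows from membership in
    \<open>alpha_codomain n\<close>.\<close>
  have "alpha n \<sigma> permutes {1..n}" if "\<sigma> \<in> derangements n" for \<sigma>
  proof -
    have "alpha n \<sigma> \<in> alpha_codomain n"
      using bij_betwE[OF bij_betw_alpha] that derangements_subset_alpha_domain by blast
    then show ?thesis
      using pi_perm_permutes
      by (auto simp: alpha_codomain_def one_fixpoint_perms_def split: if_splits)
  qed
  then have "2 \<le> run_start n \<sigma> \<and> alpha n \<sigma> permutes {1..n} \<and>
      (\<sigma> (\<sigma> (run_start n \<sigma> - 1)) = run_start n \<sigma> - 1 \<longrightarrow>
        merge_formula n (run_start n \<sigma>) \<sigma> (alpha n \<sigma>)) \<and>
      (\<sigma> (\<sigma> (run_start n \<sigma> - 1)) \<noteq> run_start n \<sigma> - 1 \<longrightarrow>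
        split_formula n (run_start n \<sigma>) \<sigma> (alpha n \<sigma>))"
    if "\<sigma> \<in> derangements n" "\<sigma> \<noteq> pi_perm n" for \<sigma>
    using alpha_formula[OF assms that] that by simp
  then show ?thesis
    using alpha_pi_perm[OF assms] unfolding merge_formula_def split_formula_def Let_def by blast
qed

end
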